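(* Let $m\ge 1$ and $n\ge 2$, and let $(G,H)\in\mathcal{BH}(m,n)\times\mathcal{BH}(m,n)$. Let $\mathbb{X}=\{\mathcal{X}^{(1)},\dots,\mathcal{X}^{(n-2)}\}$ be a complete tensor set of LSESC of order $n-1$, and let $\mathbf{X}^{(s)}_k$ denote the $k$-th frontal slice of $\mathcal{X}^{(s)}$. Let $G'$ be the $(n-1)\times n$ matrix obtained from $G$ by deleting its first row, let $B_0=G'\otimes\mathbf{J}_{n-1}$, let $C$ be the core of $H$ with rows $\mathbf{c}_1,\dots,\mathbf{c}_{n-1}$, and let $$B=\left[\begin{array}{c|cccc} \mathbf{J}_{n-1}^{\top}\otimes\mathbf{c}_1&C&C&\cdots&C\\ \mathbf{J}_{n-1}^{\top}\otimes\mathbf{c}_2&\mathbf{X}^{(1)}_{1}C&\mathbf{X}^{(1)}_{2}C&\cdots&\mathbf{X}^{(1)}_{n-1}C\\ \mathbf{J}_{n-1}^{\top}\otimes\mathbf{c}_3&\mathbf{X}^{(2)}_{1}C&\mathbf{X}^{(2)}_{2}C&\cdots&\mathbf{X}^{(2)}_{n-1}C\\ \vdots&\vdots&\vdots&&\vdots\\ \mathbf{J}_{n-1}^{\top}\otimes\mathbf{c}_{n-1}&\mathbf{X}^{(n-2)}_{1}C&\mathbf{X}^{(n-2)}_{2}C&\cdots&\mathbf{X}^{(n-2)}_{n-1}C \end{array}\right].$$ Then the matrix $$\Phi_{\mathbb{X}}(G,H)=\left[\begin{array}{c}B_0\\ B\end{array}\right]$$ is a $BH(m,n(n-1))$.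
   Context: A Butson matrix $BH(m,n)$ is an $n\times n$ matrix $M$ whose entries are complex $m$-th roots of unity (complex numbers $z$ with $z^m=1$) and which satisfies $MM^*=nI_n$, where $M^*$ is the conjugate transpose. It is normalized if its first row and first column consist entirely of ones. $\mathcal{BH}(m,n)$ is the set of all normalized $BH(m,n)$ matrices. The core of a normalized Butson matrix of order $n$ is the $(n-1)\times(n-1)$ matrix obtained by deleting its first row and first column. $\mathbf{J}_k$ is the $1\times k$ row vector of all ones. The Kronecker product of $X=(x_{ij})$ and $Y$ is the block matrix $X\otimes Y=(x_{ij}Y)$. A Latin square of order $k$ is a $k\times k$ matrix with entries in $\{1,\dots,k\}$ in which each symbol appears exactly once in each row and in each column. Two Latin squares $L=(l_{ij})$ and $L'=(l'_{ij})$ of order $k$ are said to be LSESC (Latin squares eligible for Scarpis construction) if for all $i,i'\in\{1,\dots,k\}$ there is a unique $j\in\{1,\dots,k\}$ with $l_{ij}=l'_{i'j}$. A complete set of LSESC of order $k$ is a set $\{L^{(1)},\dots,L^{(k-1)}\}$ of $k-1$ Latin squares of order $k$ such that any two distinct members are LSESC. To a Latin square $L$ of order $k$ associate the cubic tensor $F(L)$ of dimensions $k\times k\times k$ whose frontal slices are the $k\times k$ permutation matrices $\mathbf{X}_1,\dots,\mathbf{X}_k$, where the $(i,j)$ entry of $\mathbf{X}_t$ is $1$ if $l_{it}=j$ and $0$ otherwise. A complete tensor set of LSESC of order $k$ is $\{F(L^{(1)}),\dots,F(L^{(k-1)})\}$ for a complete set of LSESC $\{L^{(1)},\dots,L^{(k-1)}\}$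 of order $k$. *)

theory Defs
  imports
    "HOL-Analysis.Analysis"
    "Jordan_Normal_Form.Determinant"
    "Jordan_Normal_Form.Schur_Decomposition"
begin

text \<open>Matrices are those of \<^theory>\<open>Jordan_Normal_Form.Matrix\<close>, so rows and columns are numbered
  from 0: row \<open>i\<close> in the usual numbering is row \<open>i - 1\<close> here. The symbols of a Latin square of
  order \<open>k\<close> are kept as \<open>1, \<dots>, k\<close>.\<close>

definition butson :: "nat \<Rightarrow> nat \<Rightarrow> complex mat \<Rightarrow> bool" where
  "butson m n M \<longleftrightarrow>
     M \<in> carrier_mat n n \<and>
     (\<forall>i<n. \<forall>j<n. (M $$ (i, j)) ^ m = 1) \<and>
     M * mat_adjoint M = of_nat n \<cdot>\<^sub>m 1\<^sub>m n"

definition normalized_butson :: "nat \<Rightarrow> nat \<Rightarrow> complex mat set" where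
  "normalized_butson m n =
     {M. butson m n M \<and> (\<forall>j<n. M $$ (0, j) = 1) \<and> (\<forall>i<n. M $$ (i, 0) = 1)}"

definition butson_core :: "'a mat \<Rightarrow> 'a mat" where
  "butson_core M = mat_delete M 0 0"

definition delete_first_row :: "'a mat \<Rightarrow> 'a mat" where
  "delete_first_row M = mat (dim_row M - 1) (dim_col M) (\<lambda>(i, j). M $$ (Suc i, j))"

definition ones_row :: "nat \<Rightarrow> complex mat" where
  "ones_row k = mat 1 k (\<lambda>_. 1)"

text \<open>\<open>block_matrix r c p q Bl\<close> consists of \<open>r \<times> c\<close> blocks \<open>Bl a b\<close>, each of size \<open>p \<times> q\<close>.\<close>

definition block_matrix ::
  "nat \<Rightarrow> nat \<Rightarrow> nat \<Rightarrow> nat \<Rightarrow> (nat \<Rightarrow> nat \<Rightarrow> 'a mat) \<Rightarrow> 'a mat" where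
  "block_matrix r c p q Bl =
     mat (r * p) (c * q) (\<lambda>(i, j). Bl (i div p) (j div q) $$ (i mod p, j mod q))"

definition kronecker :: "'a::times mat \<Rightarrow> 'a mat \<Rightarrow> 'a mat" where
  "kronecker X Y =
     block_matrix (dim_row X) (dim_col X) (dim_row Y) (dim_col Y) (\<lambda>i j. X $$ (i, j) \<cdot>\<^sub>m Y)"

definition latin_square :: "nat \<Rightarrow> nat mat \<Rightarrow> bool" where
  "latin_square k L \<longleftrightarrow>
     L \<in> carrier_mat k k \<and>
     (\<forall>i<k. \<forall>j<k. L $$ (i, j) \<in> {1..k}) \<and>
     (\<forall>i<k. \<forall>s\<in>{1..k}. \<exists>!j. j < k \<and> L $$ (i, j) = s) \<and>
     (\<forall>j<k. \<forall>s\<in>{1..k}. \<exists>!i. i < k \<and> L $$ (i, j) = s)"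

definition LSESC :: "nat \<Rightarrow> nat mat \<Rightarrow> nat mat \<Rightarrow> bool" where
  "LSESC k L L' \<longleftrightarrow>
     latin_square k L \<and> latin_square k L' \<and>
     (\<forall>i<k. \<forall>i'<k. \<exists>!j. j < k \<and> L $$ (i, j) = L' $$ (i', j))"

definition complete_LSESC :: "nat \<Rightarrow> nat mat set \<Rightarrow> bool" where
  "complete_LSESC k \<L> \<longleftrightarrow>
     finite \<L> \<and> card \<L> = k - 1 \<and>
     (\<forall>L\<in>\<L>. latin_square k L) \<and>
     (\<forall>L\<in>\<L>. \<forall>L'\<in>\<L>. L \<noteq> L' \<longrightarrow> LSESC k L L')"

text \<open>A three-dimensional tensor is given by the list of its frontal slices.\<close>

type_synonym 'a tensor = "'a mat list"

text \<open>Slices are counted from 1.\<close>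

definition frontal_slice :: "'a tensor \<Rightarrow> nat \<Rightarrow> 'a mat" where
  "frontal_slice T t = T ! (t - 1)"

text \<open>Since columns are counted from 0, the symbol \<open>l\<close> selects the column \<open>l - 1\<close>.\<close>

definition latin_tensor :: "nat mat \<Rightarrow> complex tensor" where
  "latin_tensor L =
     map (\<lambda>t. mat (dim_row L) (dim_row L) (\<lambda>(i, j). if L $$ (i, t) = Suc j then 1 else 0))
       [0..<dim_row L]"

definition complete_tensor_set :: "nat \<Rightarrow> complex tensor set \<Rightarrow> bool" where
  "complete_tensor_set k \<T> \<longleftrightarrow> (\<exists>\<L>. complete_LSESC k \<L> \<and> \<T> = latin_tensor ` \<L>)"

text \<open>With \<open>k\<close> the order of \<open>C\<close>: the block in block row \<open>a < k\<close> and block column \<open>b \<le> k\<close>, both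
  counted from 0. Block row \<open>a > 0\<close> uses the tensor with label \<open>a\<close>.\<close>

definition scarpis_block ::
  "(nat \<Rightarrow> complex tensor) \<Rightarrow> complex mat \<Rightarrow> nat \<Rightarrow> nat \<Rightarrow> complex mat" where
  "scarpis_block X C a b =
     (if b = 0 then kronecker (transpose_mat (ones_row (dim_row C))) (mat_of_row (row C a))
      else if a = 0 then C
      else frontal_slice (X a) b * C)"

definition scarpis_lower :: "(nat \<Rightarrow> complex tensor) \<Rightarrow> complex mat \<Rightarrow> complex mat" where
  "scarpis_lower X C =
     (let k = dim_row C in block_matrix k (k + 1) k k (scarpis_block X C))"

definition scarpis ::
  "(nat \<Rightarrow> complex tensor) \<Rightarrow> complex mat \<Rightarrow> complex mat \<Rightarrow> complex mat" where
  "scarpis X G H =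
     kronecker (delete_first_row G) (ones_row (dim_row H - 1))
       @\<^sub>r scarpis_lower X (butson_core H)"

end

theory Submission
  imports Defs
begin

text \<open>Put \<open>k = n - 1\<close>. In the lower part, each row is indexed by a pair \<open>(a, r)\<close>, and its piece in
  block column \<open>q\<close> is a single row of the core of \<open>H\<close>, say with number \<open>\<tau> a r q\<close>. The complete set of
  LSESC makes \<open>\<tau>\<close> an orthogonal array: two distinct rows \<open>(a, r)\<close> and \<open>(a', r')\<close> agree in exactly one of
  the \<open>n\<close> block columns. Rows of the core have inner product \<open>n - 1\<close> if they are equal and \<open>-1\<close>
  otherwise, so the rows of the lower part have inner product \<open>n \<cdot> #{q. agreement} - n\<close>, which is 0
  when they are distinct. Each row of the core sums to \<open>-1\<close>, so the inner product of an upper and a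
  lower row is minus the sum of a row of \<open>G\<close> other than the first, which vanishes.\<close>

section \<open>Inner products and row sums of normalized Butson matrices\<close>

text \<open>The entries of \<open>M * mat_adjoint M\<close> are the Hermitian inner products of the
  rows of \<open>M\<close>, so orthogonality can be checked pair of rows by pair of rows.\<close>

lemma butson_iff:
  "butson m n M \<longleftrightarrow>
     M \<in> carrier_mat n n \<and>
     (\<forall>i<n. \<forall>j<n. (M $$ (i, j)) ^ m = 1) \<and>
     (\<forall>i<n. \<forall>i'<n. (\<Sum>j<n. M $$ (i, j) * cnj (M $$ (i', j))) = (if i = i' then of_nat n else 0))"
proof (cases "M \<in> carrier_mat n n")
  case True
  have entry: "(M * mat_adjoint M) $$ (i, i') = (\<Sum>j<n. M $$ (i, j) * cnj (M $$ (i', j)))"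
    if "i < n" "i' < n" for i i'
    using True that by (auto simp: mat_adjoint_def scalar_prod_def mat_of_rows_index atLeast0LessThan intro!: sum.cong)
  have "M * mat_adjoint M = of_nat n \<cdot>\<^sub>m 1\<^sub>m n \<longleftrightarrow>
      (\<forall>i<n. \<forall>i'<n. (M * mat_adjoint M) $$ (i, i') = (if i = i' then of_nat n else 0))"
    using True by (subst mat_eq_iff) (auto simp: mat_adjoint_def)
  then show ?thesis
    using True entry by (simp add: butson_def)
qed (simp add: butson_def)

text \<open>Splits a sum over matrix columns into block columns and positions inside a block,
  through the unique representation j = a * q + b with b < q.\<close>

lemma sum_div_mod:
  fixes f :: "nat \<Rightarrow> nat \<Rightarrow> 'a::comm_monoid_add"
  shows "(\<Sum>j<c * q. f (j div q) (j mod q)) = (\<Sum>a<c. \<Sum>b<q. f a b)"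
proof -
  have "(\<Sum>j\<in>{a * q..<a * q + q}. f (j div q) (j mod q)) = (\<Sum>b<q. f a b)" for a
  proof -
    have "(\<Sum>j\<in>{a * q..<a * q + q}. f (j div q) (j mod q))
        = (\<Sum>b\<in>{0..<q}. f ((b + a * q) div q) ((b + a * q) mod q))"
      using sum.shift_bounds_nat_ivl[of "\<lambda>j. f (j div q) (j mod q)" 0 "a * q" q]
      by (simp add: add.commute)
    also have "\<dots> = (\<Sum>b<q. f a b)"
      by (rule sum.cong) auto
    finally show ?thesis .
  qed
  then show ?thesis
    by (simp add: sum.nat_group[symmetric])
qed

text \<open>Deleting the first column removes exactly the term 1 * 1 from the inner product of two
  full rows.\<close>

lemma normalized_core_row_inner:
  assumes "H \<in> normalized_butson m (Suc k)" "i < k" "i' < k"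
  shows "(\<Sum>s<k. H $$ (Suc i, Suc s) * cnj (H $$ (Suc i', Suc s)))
    = (if i = i' then of_nat (Suc k) else 0) - 1"
proof -
  have "(\<Sum>s<Suc k. H $$ (Suc i, s) * cnj (H $$ (Suc i', s)))
      = (if Suc i = Suc i' then of_nat (Suc k) else 0)"
    using assms unfolding normalized_butson_def butson_iff by blast
  moreover have "H $$ (Suc i, 0) = 1" "H $$ (Suc i', 0) = 1"
    using assms by (auto simp: normalized_butson_def)
  ultimately show ?thesis
    by (simp add: sum.lessThan_Suc_shift algebra_simps del: sum.lessThan_Suc split: if_splits)
qed

text \<open>Row \<open>i\<close> is orthogonal to row 0, which is all ones.\<close>

lemma normalized_row_sum:
  assumes "H \<in> normalized_butson m n" "0 < i" "i < n"
  shows "(\<Sum>s<n. H $$ (i, s)) = 0"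
proof -
  have "(\<Sum>s<n. H $$ (i, s) * cnj (H $$ (0, s))) = (if i = 0 then of_nat n else 0)"
    using assms order.strict_trans[OF assms(2,3)] unfolding normalized_butson_def butson_iff by blast
  moreover have "H $$ (0, s) = 1" if "s < n" for s
    using assms that by (auto simp: normalized_butson_def)
  ultimately show ?thesis
    using \<open>0 < i\<close> by simp
qed

lemma normalized_core_row_sum:
  assumes "H \<in> normalized_butson m (Suc k)" "i < k"
  shows "(\<Sum>s<k. H $$ (Suc i, Suc s)) = -1"
proof -
  have "(\<Sum>s<Suc k. H $$ (Suc i, s)) = 0"
    using assms by (intro normalized_row_sum) auto
  moreover have "H $$ (Suc i, 0) = 1"
    using assms by (auto simp: normalized_butson_def)
  ultimately show ?thesis
    by (simp add: sum.lessThan_Suc_shift add_eq_0_iff del: sum.lessThan_Suc)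
qed

section \<open>From an orthogonal array to a Butson matrix\<close>

text \<open>Separates the linear algebra from the combinatorics: the Latin squares enter through the
  array \<tau>, its range and its agreement property. Each \<open>Suc\<close> in an index of
  \<open>H\<close> skips the border of ones and so addresses the core.\<close>

lemma butson_of_array:
  fixes \<tau> :: "nat \<Rightarrow> nat \<Rightarrow> nat \<Rightarrow> nat"
  assumes G: "G \<in> normalized_butson m (Suc k)" and H: "H \<in> normalized_butson m (Suc k)"
    and M: "M \<in> carrier_mat (Suc k * k) (Suc k * k)"
    and upper: "\<And>i j. i < k \<Longrightarrow> j < Suc k * k \<Longrightarrow> M $$ (i, j) = G $$ (Suc i, j div k)"
    and lower: "\<And>i j. i < k * k \<Longrightarrow> j < Suc k * k \<Longrightarrow>
      M $$ (k + i, j) = H $$ (Suc (\<tau> (i div k) (i mod k) (j div k)), Suc (j mod k))"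
    and range: "\<And>a r q. a < k \<Longrightarrow> r < k \<Longrightarrow> q < Suc k \<Longrightarrow> \<tau> a r q < k"
    and agree: "\<And>a r a' r'. a < k \<Longrightarrow> r < k \<Longrightarrow> a' < k \<Longrightarrow> r' < k \<Longrightarrow> (a, r) \<noteq> (a', r') \<Longrightarrow>
      \<exists>!q. q < Suc k \<and> \<tau> a r q = \<tau> a' r' q"
  shows "butson m (Suc k * k) M"
proof -
  define N where "N = Suc k * k"
  have N: "N = k + k * k"
    by (simp add: N_def)
  have div_less: "j div k < Suc k" if "j < N" for j
    using that by (simp add: N_def less_mult_imp_div_less)
  \<comment> \<open>For \<open>k = 0\<close> also \<open>N = 0\<close>, so there is no such
    \<open>j\<close>.\<close>
  have mod_less: "j mod k < k" if "j < N" for j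
    using that by (cases "k = 0") (auto simp: N_def)
  have lower_cases: "\<not> i < k \<Longrightarrow> i < N \<Longrightarrow> \<exists>i0<k * k. i = k + i0" for i
    unfolding N by (intro exI[of _ "i - k"]) auto
  have div_mod_less: "i div k < k" "i mod k < k" if "i < k * k" for i
    using that by (cases "k = 0"; simp add: less_mult_imp_div_less)+
  define ip where "ip i i' = (\<Sum>j<N. M $$ (i, j) * cnj (M $$ (i', j)))" for i i'

  have roots: "(M $$ (i, j)) ^ m = 1" if "i < N" "j < N" for i j
  proof (cases "i < k")
    case True
    then show ?thesis
      using G upper[OF True] div_less[OF that(2)] that
      by (auto simp: normalized_butson_def butson_def N_def)
  next
    case False
    then obtain i0 where i0: "i0 < k * k" "i = k + i0"
      using lower_cases[OF False \<open>i < N\<close>] by blast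
    let ?t = "\<tau> (i0 div k) (i0 mod k) (j div k)"
    have "M $$ (i, j) = H $$ (Suc ?t, Suc (j mod k))"
      using lower[OF i0(1)] i0(2) \<open>j < N\<close> unfolding N_def by blast
    moreover have "Suc ?t < Suc k" "Suc (j mod k) < Suc k"
      using range[OF div_mod_less[OF i0(1)] div_less[OF \<open>j < N\<close>]] mod_less[OF \<open>j < N\<close>] by simp_all
    ultimately show ?thesis
      using H unfolding normalized_butson_def butson_def by simp
  qed

  have upper_upper: "ip i i' = (if i = i' then of_nat N else 0)" if "i < k" "i' < k" for i i'
  proof -
    have "ip i i' = (\<Sum>j<Suc k * k. G $$ (Suc i, j div k) * cnj (G $$ (Suc i', j div k)))"
      using that by (simp add: ip_def N_def upper del: mult_Suc)
    also have "\<dots> = (\<Sum>q<Suc k. \<Sum>s<k. G $$ (Suc i, q) * cnj (G $$ (Suc i', q)))"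
      by (rule sum_div_mod)
    \<comment> \<open>Upper rows are constant on each block column, so every term occurs
      \<open>k\<close> times.\<close>
    also have "\<dots> = of_nat k * (\<Sum>q<Suc k. G $$ (Suc i, q) * cnj (G $$ (Suc i', q)))"
      by (simp add: sum_distrib_left del: sum.lessThan_Suc)
    also have "(\<Sum>q<Suc k. G $$ (Suc i, q) * cnj (G $$ (Suc i', q)))
        = (if Suc i = Suc i' then of_nat (Suc k) else 0)"
      using G that unfolding normalized_butson_def butson_iff by blast
    finally show ?thesis
      by (simp add: N_def algebra_simps)
  qed

  have upper_lower: "ip i (k + i') = 0" if "i < k" "i' < k * k" for i i'
  proof -
    let ?a = "i' div k" and ?r = "i' mod k"
    have "ip i (k + i') = (\<Sum>j<Suc k * k. G $$ (Suc i, j div k) *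
        cnj (H $$ (Suc (\<tau> ?a ?r (j div k)), Suc (j mod k))))"
      using that by (simp add: ip_def N_def upper lower del: mult_Suc)
    also have "\<dots> = (\<Sum>q<Suc k. \<Sum>s<k. G $$ (Suc i, q) * cnj (H $$ (Suc (\<tau> ?a ?r q), Suc s)))"
      by (rule sum_div_mod)
    also have "\<dots> = (\<Sum>q<Suc k. G $$ (Suc i, q) * cnj (\<Sum>s<k. H $$ (Suc (\<tau> ?a ?r q), Suc s)))"
      by (simp add: sum_distrib_left del: sum.lessThan_Suc)
    also have "\<dots> = (\<Sum>q<Suc k. G $$ (Suc i, q) * (-1))"
      using range div_mod_less[OF that(2)] normalized_core_row_sum[OF H]
      by (intro sum.cong) (auto simp del: sum.lessThan_Suc)
    \<comment> \<open>Row \<open>Suc i\<close> of \<open>G\<close> is not the first one, so its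
      entries sum to 0.\<close>
    also have "\<dots> = 0"
      using normalized_row_sum[OF G, of "Suc i"] that
      by (simp only: sum_distrib_right[symmetric]) simp
    finally show ?thesis .
  qed

  have lower_lower: "ip (k + i) (k + i') = (if i = i' then of_nat N else 0)"
    if "i < k * k" "i' < k * k" for i i'
  proof -
    let ?t = "\<tau> (i div k) (i mod k)" and ?t' = "\<tau> (i' div k) (i' mod k)"
    have "ip (k + i) (k + i') = (\<Sum>j<Suc k * k. H $$ (Suc (?t (j div k)), Suc (j mod k)) *
        cnj (H $$ (Suc (?t' (j div k)), Suc (j mod k))))"
      using that by (simp add: ip_def N_def lower del: mult_Suc)
    also have "\<dots> = (\<Sum>q<Suc k. \<Sum>s<k. H $$ (Suc (?t q), Suc s) * cnj (H $$ (Suc (?t' q), Suc s)))"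
      by (rule sum_div_mod)
    also have "\<dots> = (\<Sum>q<Suc k. (if ?t q = ?t' q then of_nat (Suc k) else 0) - 1)"
      using range div_mod_less[OF that(1)] div_mod_less[OF that(2)] normalized_core_row_inner[OF H]
      by (intro sum.cong) auto
    also have "\<dots> = (\<Sum>q<Suc k. if ?t q = ?t' q then of_nat (Suc k) else 0) - of_nat (Suc k)"
      by (simp add: sum_subtractf del: sum.lessThan_Suc)
    also have "\<dots> = (if i = i' then of_nat N else 0)"
    proof (cases "i = i'")
      \<comment> \<open>All k + 1 block columns agree, which gives (k + 1)^2 - (k + 1) = N.\<close>
      case True
      then show ?thesis
        by (simp add: N_def algebra_simps)
    next
      case False
      then have "(i div k, i mod k) \<noteq> (i' div k, i' mod k)"
        by (metis Pair_inject div_mult_mod_eq)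
      then have "\<exists>!q. q < Suc k \<and> ?t q = ?t' q"
        using div_mod_less that by (intro agree)
      then obtain q where "q < Suc k \<and> ?t q = ?t' q" "\<And>p. p < Suc k \<and> ?t p = ?t' p \<Longrightarrow> p = q"
        by (elim ex1E) blast
      \<comment> \<open>A single agreement contributes k + 1 once and cancels the subtracted k +
        1.\<close>
      then have q: "{q. q < Suc k \<and> ?t q = ?t' q} = {q}"
        by blast
      have "(\<Sum>q<Suc k. if ?t q = ?t' q then of_nat (Suc k) else (0::complex))
          = (\<Sum>q\<in>{q. q < Suc k \<and> ?t q = ?t' q}. of_nat (Suc k))"
        by (subst sum.inter_filter[symmetric]) (auto intro!: sum.cong)
      then show ?thesis
        using False by (simp add: q del: sum.lessThan_Suc)
    qed
    finally show ?thesis .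
  qed

  \<comment> \<open>Hermitian symmetry reduces the case of a lower and an upper row to
    \<open>upper_lower\<close>.\<close>
  have ip_cnj: "ip i' i = cnj (ip i i')" for i i'
    by (simp add: ip_def mult.commute)
  have "ip i i' = (if i = i' then of_nat N else 0)" if "i < N" "i' < N" for i i'
  proof (cases "i < k")
    case True
    show ?thesis
    proof (cases "i' < k")
      case False
      then obtain j where "j < k * k" "i' = k + j"
        using lower_cases[OF False \<open>i' < N\<close>] by blast
      then show ?thesis
        using upper_lower True by auto
    qed (use upper_upper True in auto)
  next
    case False
    then obtain j where j: "j < k * k" "i = k + j"
      using lower_cases[OF False \<open>i < N\<close>] by blast
    show ?thesis
    proof (cases "i' < k")
      case True
      then show ?thesis
        using upper_lower[of i' j] j ip_cnj[of i i'] by auto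
    next
      case False
      then obtain j' where "j' < k * k" "i' = k + j'"
        using lower_cases[OF False \<open>i' < N\<close>] by blast
      then show ?thesis
        using lower_lower j by auto
    qed
  qed
  then show ?thesis
    using M roots unfolding butson_iff N_def ip_def by blast
qed

section \<open>The orthogonal array of a complete set of LSESC\<close>

text \<open>The number, counted from 0, of the core row found in block column \<open>q\<close> of
  row \<open>r\<close> of block row \<open>a\<close>. Block column 0 repeats core row
  \<open>a\<close>; block row 0 holds \<open>C\<close> itself, hence \<open>r\<close>. Otherwise
  slice \<open>q\<close> belongs to column \<open>q - 1\<close> of the square, and the final
  \<open>- 1\<close> turns a symbol into a row number.\<close>

definition scarpis_array :: "(nat \<Rightarrow> nat mat) \<Rightarrow> nat \<Rightarrow> nat \<Rightarrow> nat \<Rightarrow> nat" where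
  "scarpis_array L a r q =
     (if q = 0 then a else if a = 0 then r else L a $$ (r, q - 1) - 1)"

lemma scarpis_array_less:
  assumes "\<And>a. 0 < a \<Longrightarrow> a < k \<Longrightarrow> latin_square k (L a)" "a < k" "r < k" "q < Suc k"
  shows "scarpis_array L a r q < k"
proof (cases "q = 0 \<or> a = 0")
  case False
  then have "L a $$ (r, q - 1) \<in> {1..k}"
    using assms by (auto simp: latin_square_def)
  then show ?thesis
    using False by (auto simp: scarpis_array_def)
qed (use assms in \<open>auto simp: scarpis_array_def\<close>)

lemma Ex1_less_Suc_shift:
  assumes "\<not> P 0" "\<exists>!q. q < k \<and> P (Suc q)"
  shows "\<exists>!q. q < Suc k \<and> P q"
  using assms by (metis Suc_less_eq not0_implies_Suc)

text \<open>Rows with the same label \<open>a\<close> meet in column 0 and, the columns of a Latin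
  square being injective, nowhere else. Rows with different labels differ in column 0 and meet once
  later: by the LSESC property, or, if one label is 0, because each symbol occurs once in a
  row.\<close>

lemma scarpis_array_agree:
  assumes latin: "\<And>a. 0 < a \<Longrightarrow> a < k \<Longrightarrow> latin_square k (L a)"
    and pair: "\<And>a a'. 0 < a \<Longrightarrow> a < k \<Longrightarrow> 0 < a' \<Longrightarrow> a' < k \<Longrightarrow> a \<noteq> a' \<Longrightarrow> LSESC k (L a) (L a')"
    and bounds: "a < k" "r < k" "a' < k" "r' < k"
    and neq: "(a, r) \<noteq> (a', r')"
  shows "\<exists>!q. q < Suc k \<and> scarpis_array L a r q = scarpis_array L a' r' q"
proof -
  have sym: "L b $$ (x, q) \<in> {1..k}" if "0 < b" "b < k" "x < k" "q < k" for b x q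
    using latin that by (auto simp: latin_square_def)
  \<comment> \<open>Symbols are at least 1, so the truncated subtraction loses nothing.\<close>
  have pred_eq: "L b $$ (x, q) - 1 = y \<longleftrightarrow> L b $$ (x, q) = Suc y"
    if "0 < b" "b < k" "x < k" "q < k" for b x y q
    using sym[OF that] by auto
  have row: "\<exists>!q. q < k \<and> L b $$ (x, q) - 1 = y" if "0 < b" "b < k" "x < k" "y < k" for b x y
  proof -
    have "\<exists>!q. q < k \<and> L b $$ (x, q) = Suc y"
      using latin[of b] that by (simp add: latin_square_def)
    then show ?thesis
      using pred_eq that by (metis (no_types, lifting))
  qed
  show ?thesis
  proof (cases "a = a'")
    case True
    then have "r \<noteq> r'"
      using neq by simp
    moreover have "L a $$ (r, q) - 1 \<noteq> L a $$ (r', q) - 1" if "0 < a" "q < k" for q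
    proof
      assume "L a $$ (r, q) - 1 = L a $$ (r', q) - 1"
      then have eq: "L a $$ (r, q) = L a $$ (r', q)"
        using sym[of a r q] sym[of a r' q] that bounds True by auto
      have "\<exists>!i. i < k \<and> L a $$ (i, q) = L a $$ (r, q)"
        using latin[of a] sym[of a r q] that bounds by (simp add: latin_square_def)
      then show False
        using eq bounds \<open>r \<noteq> r'\<close> by metis
    qed
    ultimately show ?thesis
      \<comment> \<open>For \<open>a = 0\<close> the columns after 0 hold the constants
        \<open>r\<close> and \<open>r'\<close>, which differ.\<close>
      using True by (intro ex1I[of _ 0]) (auto simp: scarpis_array_def split: if_splits)
  next
    case False
    show ?thesis
    proof (rule Ex1_less_Suc_shift)
      show "scarpis_array L a r 0 \<noteq> scarpis_array L a' r' 0"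
        using False by (simp add: scarpis_array_def)
      consider "a = 0" "0 < a'" | "0 < a" "a' = 0" | "0 < a" "0 < a'"
        using False by auto
      then show "\<exists>!q. q < k \<and> scarpis_array L a r (Suc q) = scarpis_array L a' r' (Suc q)"
      proof cases
        \<comment> \<open>The row with label 0 is constantly \<open>r\<close>, and the symbol
          \<open>Suc r\<close> occurs exactly once in row \<open>r'\<close> of
          \<open>L a'\<close>.\<close>
        case 1
        then show ?thesis
          using row[of a' r' r] bounds by (simp add: scarpis_array_def eq_commute[of r])
      next
        case 2
        then show ?thesis
          using row[of a r r'] bounds by (simp add: scarpis_array_def)
      next
        case 3
        have "\<exists>!q. q < k \<and> L a $$ (r, q) = L a' $$ (r', q)"
          using pair[of a a'] 3 False bounds by (simp add: LSESC_def)
        moreover have "L a $$ (r, q) - 1 = L a' $$ (r', q) - 1 \<longleftrightarrow> L a $$ (r, q) = L a' $$ (r', q)"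
          if "q < k" for q
          using sym[of a r q] sym[of a' r' q] that 3 bounds by auto
        ultimately have "\<exists>!q. q < k \<and> L a $$ (r, q) - 1 = L a' $$ (r', q) - 1"
          by (metis (no_types, lifting))
        then show ?thesis
          using 3 by (simp add: scarpis_array_def)
      qed
    qed
  qed
qed

section \<open>Entries of the Scarpis matrix\<close>

text \<open>Row \<open>r\<close> of the slice is a unit vector whose 1 stands in column
  \<open>L $$ (r, q) - 1\<close>, so the product picks out that row of \<open>C\<close>.\<close>

lemma frontal_slice_latin_tensor_mult:
  assumes L: "latin_square k L" and C: "C \<in> carrier_mat k c"
    and "q < k" "r < k" "s < c"
  shows "(frontal_slice (latin_tensor L) (Suc q) * C) $$ (r, s) = C $$ (L $$ (r, q) - 1, s)"
proof -
  have dim: "dim_row L = k" and sym: "L $$ (r, q) \<in> {1..k}"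
    using assms by (auto simp: latin_square_def)
  have "frontal_slice (latin_tensor L) (Suc q)
      = mat k k (\<lambda>(i, j). if L $$ (i, q) = Suc j then 1 else 0)"
    using dim \<open>q < k\<close> by (simp add: frontal_slice_def latin_tensor_def)
  then have "(frontal_slice (latin_tensor L) (Suc q) * C) $$ (r, s)
      = (\<Sum>j<k. (if L $$ (r, q) = Suc j then 1 else 0) * C $$ (j, s))"
    using assms by (simp add: scalar_prod_def atLeast0LessThan)
  also have "\<dots> = (\<Sum>j<k. if j = L $$ (r, q) - 1 then C $$ (j, s) else 0)"
    using sym by (intro sum.cong) auto
  also have "\<dots> = C $$ (L $$ (r, q) - 1, s)"
    using sym by auto
  finally show ?thesis .
qed

lemma butson_core_index:
  assumes "H \<in> carrier_mat (Suc k) (Suc k)" "i < k" "j < k"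
  shows "butson_core H $$ (i, j) = H $$ (Suc i, Suc j)"
  using assms by (simp add: butson_core_def mat_delete_def)

lemma scarpis_block_index:
  assumes C: "C \<in> carrier_mat k k"
    and L: "\<And>a. 0 < a \<Longrightarrow> a < k \<Longrightarrow> latin_square k (L a) \<and> X a = latin_tensor (L a)"
    and "a < k" "q < Suc k" "r < k" "s < k"
  shows "scarpis_block X C a q $$ (r, s) = C $$ (scarpis_array L a r q, s)"
proof (cases "q = 0 \<or> a = 0")
  case True
  then show ?thesis
    using assms by (auto simp: scarpis_block_def scarpis_array_def kronecker_def block_matrix_def
        ones_row_def mat_of_row_def)
next
  case False
  then show ?thesis
    using frontal_slice_latin_tensor_mult[of k "L a" C k "q - 1" r s] L[of a] assms
    by (auto simp: scarpis_block_def scarpis_array_def)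
qed

text \<open>Chooses for each label a square that yields its tensor. Distinct labels have distinct
  tensors, hence distinct squares, and distinct members of a complete set are LSESC.\<close>

lemma complete_tensor_set_latin_squares:
  assumes "complete_tensor_set k \<T>" "inj_on X A" "X ` A = \<T>"
  obtains L where "\<And>a. a \<in> A \<Longrightarrow> latin_square k (L a) \<and> X a = latin_tensor (L a)"
    and "\<And>a a'. a \<in> A \<Longrightarrow> a' \<in> A \<Longrightarrow> a \<noteq> a' \<Longrightarrow> LSESC k (L a) (L a')"
proof -
  obtain \<L> where \<L>: "complete_LSESC k \<L>" "\<T> = latin_tensor ` \<L>"
    using assms by (auto simp: complete_tensor_set_def)
  then have "\<forall>a\<in>A. \<exists>K\<in>\<L>. X a = latin_tensor K"
    using assms by blast
  then obtain L where L: "\<And>a. a \<in> A \<Longrightarrow> L a \<in> \<L> \<and> X a = latin_tensor (L a)"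
    by metis
  have "L a \<noteq> L a'" if "a \<in> A" "a' \<in> A" "a \<noteq> a'" for a a'
    using that L assms(2) by (metis inj_onD)
  then show thesis
    using L \<L>(1) by (intro that[of L]) (simp_all add: complete_LSESC_def)
qed

theorem corollary1:
  fixes m n :: nat
    and G H :: "complex mat"
    and \<T> :: "complex tensor set"
    and X :: "nat \<Rightarrow> complex tensor"
  assumes "m \<ge> 1" and "n \<ge> 2"
    and "(G, H) \<in> normalized_butson m n \<times> normalized_butson m n"
    and "complete_tensor_set (n - 1) \<T>"
    and "bij_betw X {1..n - 2} \<T>"
  shows "butson m (n * (n - 1)) (scarpis X G H)"
proof -
  define k where "k = n - 1"
  have n: "n = Suc k" and k: "0 < k"
    using assms(2) by (auto simp: k_def)
  have G: "G \<in> normalized_butson m (Suc k)" and H: "H \<in> normalized_butson m (Suc k)"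
    using assms(3) n by auto
  have Gc: "G \<in> carrier_mat (Suc k) (Suc k)" and Hc: "H \<in> carrier_mat (Suc k) (Suc k)"
    using G H by (auto simp: normalized_butson_def butson_def)
  obtain L where "\<And>a. a \<in> {1..n - 2} \<Longrightarrow> latin_square k (L a) \<and> X a = latin_tensor (L a)"
    and "\<And>a a'. a \<in> {1..n - 2} \<Longrightarrow> a' \<in> {1..n - 2} \<Longrightarrow> a \<noteq> a' \<Longrightarrow> LSESC k (L a) (L a')"
    using complete_tensor_set_latin_squares assms(4,5) unfolding k_def bij_betw_def by metis
  \<comment> \<open>The labels 1 to n - 2 are precisely those with 0 < a < k, as k = n - 1.\<close>
  then have L: "\<And>a. 0 < a \<Longrightarrow> a < k \<Longrightarrow> latin_square k (L a) \<and> X a = latin_tensor (L a)"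
    and pair: "\<And>a a'. 0 < a \<Longrightarrow> a < k \<Longrightarrow> 0 < a' \<Longrightarrow> a' < k \<Longrightarrow> a \<noteq> a' \<Longrightarrow> LSESC k (L a) (L a')"
    by (auto simp: n)
  define C where "C = butson_core H"
  have C: "C \<in> carrier_mat k k"
    using Hc by (auto simp: C_def butson_core_def)
  define B0 where "B0 = kronecker (delete_first_row G) (ones_row (dim_row H - 1))"
  \<comment> \<open>The Kronecker factor of ones has width \<open>k\<close>, so column
    \<open>j\<close> carries the entry from column \<open>j div k\<close> of
    \<open>G\<close>.\<close>
  have B0: "B0 \<in> carrier_mat k (Suc k * k)"
    and B0_index: "\<And>i j. i < k \<Longrightarrow> j < Suc k * k \<Longrightarrow> B0 $$ (i, j) = G $$ (Suc i, j div k)"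
    using Gc Hc k by (auto simp: B0_def kronecker_def block_matrix_def delete_first_row_def
        ones_row_def less_mult_imp_div_less simp del: mult_Suc)
  have B: "scarpis_lower X C \<in> carrier_mat (k * k) (Suc k * k)"
    using C by (simp add: scarpis_lower_def block_matrix_def)
  have B_index: "scarpis_lower X C $$ (i, j)
      = H $$ (Suc (scarpis_array L (i div k) (i mod k) (j div k)), Suc (j mod k))"
    if "i < k * k" "j < Suc k * k" for i j
  proof -
    have bounds: "i div k < k" "i mod k < k" "j div k < Suc k" "j mod k < k"
      using that k by (auto simp: less_mult_imp_div_less simp del: mult_Suc)
    have "scarpis_lower X C $$ (i, j) = scarpis_block X C (i div k) (j div k) $$ (i mod k, j mod k)"
      using that C by (simp add: scarpis_lower_def block_matrix_def)
    also have "\<dots> = C $$ (scarpis_array L (i div k) (i mod k) (j div k), j mod k)"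
      using bounds by (intro scarpis_block_index[OF C L])
    also have "\<dots> = H $$ (Suc (scarpis_array L (i div k) (i mod k) (j div k)), Suc (j mod k))"
      unfolding C_def using bounds L by (intro butson_core_index[OF Hc] scarpis_array_less) auto
    finally show ?thesis .
  qed
  have M: "scarpis X G H = B0 @\<^sub>r scarpis_lower X C"
    by (simp add: scarpis_def B0_def C_def)
  have "butson m (Suc k * k) (scarpis X G H)"
  proof (rule butson_of_array[OF G H])
    show "scarpis X G H \<in> carrier_mat (Suc k * k) (Suc k * k)"
      using carrier_append_rows[OF B0 B] by (simp add: M)
    show "scarpis X G H $$ (i, j) = G $$ (Suc i, j div k)" if "i < k" "j < Suc k * k" for i j
      using that B0 B B0_index by (auto simp: M append_rows_def)
    show "scarpis X G H $$ (k + i, j)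
        = H $$ (Suc (scarpis_array L (i div k) (i mod k) (j div k)), Suc (j mod k))"
      if "i < k * k" "j < Suc k * k" for i j
      using that B0 B B_index by (auto simp: M append_rows_def)
  qed (use L pair in \<open>simp_all add: scarpis_array_less scarpis_array_agree\<close>)
  then show ?thesis
    by (simp add: n)
qed

end
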